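(* Let $n>3$ and let $G_{105}$ be the dynamics group of Wolfram rule $105$ on the circular graph with $n$ vertices. When $n$ is not a multiple of $4$, $G_{105}$ is isomorphic to $(\mathbb{Z}_2^n\perp\mathbf{1})\rtimes\mathrm{Sym}_n$, and when $n$ is a multiple of $4$, $G_{105}$ is isomorphic to $\left((\mathbb{Z}_2^n\perp\mathbf{1})/\langle\mathbf{1}\rangle\right)\rtimes\mathrm{Sym}_n$. In particular, $|G_{105}|=2^{n-1}\cdot n!$ when $4\nmid n$ and $|G_{105}|=2^{n-2}\cdot n!$ when $4\mid n$.
   Context: Indices are taken modulo $n$. For $1\le i\le n$ let $F_i\colon\mathbb{F}_2^n\to\mathbb{F}_2^n$ (the local update function of Wolfram rule $105$) be the map that replaces $y_i$ by $1+y_{i-1}+y_i+y_{i+1}\bmod 2$ and leaves all other coordinates unchanged. Each $F_i$ is a bijection, every state in $\mathbb{F}_2^n$ is periodic, and the dynamics group $G_{105}$ is the group of permutations of $\mathbb{F}_2^n$ generated by $F_1,\dots,F_n$. $\mathbb{Z}_2=\mathbb{Z}/2\mathbb{Z}$, $\mathbf{1}=(1,1,\dots,1)$, and $(\mathbb{Z}_2^n\perp\mathbf{1})$ is the additive group of vectors in $\mathbb{Z}_2^n$ whose coordinates sum to $0$. The symmetric group $\mathrm{Sym}_n$ acts on $(\mathbb{Z}_2^n\perp\mathbf{1})$ by permuting coordinates, and (when $n$ is even, so that $\mathbf{1}\in(\mathbb{Z}_2^n\perp\mathbf{1})$) on the quotient $(\mathbb{Z}_2^n\perp\mathbf{1})/\langle\mathbf{1}\rangle$;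 the semidirect products are with respect to these actions. *)

theory Defs
  imports "HOL-Algebra.Algebra" "HOL-Library.Z2"
begin

text \<open>Vectors of length \<open>n\<close> over the two-element field are extensional functions on \<open>{1..n}\<close>,
  the index set on which \<^const>\<open>sym_group\<close> acts.\<close>

definition states :: "nat \<Rightarrow> (nat \<Rightarrow> bit) set" where
  "states n = {1..n} \<rightarrow>\<^sub>E UNIV"

definition cyc_pred :: "nat \<Rightarrow> nat \<Rightarrow> nat" where
  "cyc_pred n i = (if i = 1 then n else i - 1)"

definition cyc_succ :: "nat \<Rightarrow> nat \<Rightarrow> nat" where
  "cyc_succ n i = (if i = n then 1 else i + 1)"

text \<open>The restriction to \<^term>\<open>states n\<close> is required because \<^const>\<open>BijGroup\<close> only contains
  extensional permutations.\<close>

definition update105 :: "nat \<Rightarrow> nat \<Rightarrow> (nat \<Rightarrow> bit) \<Rightarrow> (nat \<Rightarrow> bit)" where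
  "update105 n i =
     (\<lambda>y \<in> states n. y(i := 1 + y (cyc_pred n i) + y i + y (cyc_succ n i)))"

text \<open>The operator \<^const>\<open>subgroup_generated\<close> discards generators outside the ambient group;
  by the following lemma none are discarded.\<close>

lemma update105_in_BijGroup:
  assumes "n > 1" and "i \<in> {1..n}"
  shows "update105 n i \<in> carrier (BijGroup (states n))"
proof -
  have ne: "cyc_pred n i \<noteq> i" "cyc_succ n i \<noteq> i"
    using assms by (auto simp: cyc_pred_def cyc_succ_def)
  have cl: "update105 n i y \<in> states n" if "y \<in> states n" for y
    using that assms by (auto simp: update105_def states_def PiE_def extensional_def)
  have inv: "update105 n i (update105 n i y) = y" if "y \<in> states n" for y
  proof
    fix j
    show "update105 n i (update105 n i y) j = y j"
      using cl[OF that, unfolded update105_def] that ne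
      by (cases "y i"; cases "y (cyc_pred n i)"; cases "y (cyc_succ n i)")
        (auto simp: update105_def)
  qed
  have "bij_betw (update105 n i) (states n) (states n)"
    by (rule bij_betw_byWitness[where f' = "update105 n i"]) (use cl inv in auto)
  then show ?thesis
    by (simp add: BijGroup_def Bij_def update105_def)
qed

definition G105 :: "nat \<Rightarrow> ((nat \<Rightarrow> bit) \<Rightarrow> (nat \<Rightarrow> bit)) monoid" where
  "G105 n = subgroup_generated (BijGroup (states n)) (update105 n ` {1..n})"

definition Z2_group :: "bit monoid" where
  "Z2_group = \<lparr>carrier = UNIV, monoid.mult = (+), one = 0\<rparr>"

definition Z2_power :: "nat \<Rightarrow> (nat \<Rightarrow> bit) monoid" where
  "Z2_power n = product_group {1..n} (\<lambda>_. Z2_group)"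

definition ones :: "nat \<Rightarrow> nat \<Rightarrow> bit" where
  "ones n = (\<lambda>i \<in> {1..n}. 1)"

definition perp_ones :: "nat \<Rightarrow> (nat \<Rightarrow> bit) monoid" where
  "perp_ones n = (Z2_power n)\<lparr>carrier := {v \<in> carrier (Z2_power n). (\<Sum>i = 1..n. v i) = 0}\<rparr>"

definition perp_ones_quot :: "nat \<Rightarrow> (nat \<Rightarrow> bit) set monoid" where
  "perp_ones_quot n = perp_ones n Mod generate (perp_ones n) {ones n}"

text \<open>Left action by permuting coordinates: the entry at position \<open>i\<close> moves to position \<open>p i\<close>.
  For \<open>p\<close> permuting \<open>{1..n}\<close> the result is again extensional on \<open>{1..n}\<close>.\<close>

definition coord_action :: "(nat \<Rightarrow> nat) \<Rightarrow> (nat \<Rightarrow> bit) \<Rightarrow> (nat \<Rightarrow> bit)" where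
  "coord_action p v = v \<circ> inv' p"

definition coset_action :: "(nat \<Rightarrow> nat) \<Rightarrow> (nat \<Rightarrow> bit) set \<Rightarrow> (nat \<Rightarrow> bit) set" where
  "coset_action p C = coord_action p ` C"

text \<open>Meaningful when \<open>\<phi>\<close> is an action of \<open>K\<close> on \<open>N\<close> by automorphisms.\<close>

definition semidirect ::
  "('a, 'm) monoid_scheme \<Rightarrow> ('b \<Rightarrow> 'a \<Rightarrow> 'a) \<Rightarrow> ('b, 'k) monoid_scheme \<Rightarrow> ('a \<times> 'b) monoid" where
  "semidirect N \<phi> K =
     \<lparr>carrier = carrier N \<times> carrier K,
      monoid.mult = (\<lambda>(a, p) (b, q). (a \<otimes>\<^bsub>N\<^esub> \<phi> p b, p \<otimes>\<^bsub>K\<^esub> q)),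
      one = (\<one>\<^bsub>N\<^esub>, \<one>\<^bsub>K\<^esub>)\<rparr>"

end

theory Submission
  imports Defs
begin

text \<open>A local update flips \<open>y\<^sub>i\<close> exactly when the two differences \<open>y\<^sub>i\<^sub>-\<^sub>1 + y\<^sub>i\<close> and
  \<open>y\<^sub>i + y\<^sub>i\<^sub>+\<^sub>1\<close> agree, and then both differences flip; if they disagree, nothing happens. In either
  case the two differences are interchanged and then both complemented. Adding \<open>i\<close> modulo 2 to the
  \<open>i\<close>-th difference absorbs the complementation at every position where the parities alternate, which
  is everywhere except, for odd \<open>n\<close>, at the wrap-around from \<open>n\<close> to \<open>1\<close>. A state \<open>y\<close> is therefore
  recorded as a pair \<open>(w, t)\<close> with \<open>w\<^sub>i = y\<^sub>i\<^sub>-\<^sub>1 + y\<^sub>i + i\<close> and \<open>t = y\<^sub>n\<close>; every \<open>w\<close> with the same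
  coordinate sum as the sequence \<open>i\<close> occurs.

  In these coordinates the update at \<open>i < n\<close> just interchanges two entries of \<open>w\<close>. The update at \<open>n\<close>
  interchanges \<open>w\<^sub>n\<close> and \<open>w\<^sub>1\<close>, complements them if \<open>n\<close> is odd, and changes \<open>t\<close> by an affine function of
  \<open>w\<close>. All of them are instances of one formula: a pair \<open>(c, p)\<close> of a vector of even weight and a
  permutation acts by
  \<open>(w, t) \<mapsto> (p w + n c, t + \<langle>c, p w\<rangle> + n q(c))\<close>, where \<open>q(c)\<close> is half the weight of \<open>c\<close> modulo 2.
  Because \<open>q\<close> is a quadratic form whose polarization is the scalar product (\<open>half_weight_add\<close>), this is
  an action of the semidirect product (\<open>act_comp\<close>). The updates are the images of the adjacent
  transpositions and of one pair with a nonzero vector, and these generate the whole semidirect product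
  (\<open>generate_generators\<close>), so the dynamics group is its image.

  It remains to find the kernel (\<open>kernel_state_perm\<close>). Differences of two codes detect the permutation, so
  it must be the identity. For odd \<open>n\<close> the first component then detects \<open>c\<close>. For even \<open>n\<close> only the
  functional \<open>w \<mapsto> \<langle>c, w\<rangle>\<close> is visible, on a coset of the vectors of even weight; it vanishes there only for
  \<open>c = 0\<close>, or for the all-ones vector when the coordinate sum \<open>1 + \<dots> + n\<close> is even, that is when \<open>4\<close>
  divides \<open>n\<close>.
  The map to the semidirect product with the quotient by the all-ones vector has that same kernel
  (\<open>quotient_hom\<close>), and homomorphisms onto two groups with equal kernels make these groups isomorphic
  (\<open>iso_if_same_kernel\<close>).\<close>

section \<open>Arithmetic of bits\<close>

(* The library rewrites bit addition to exclusive disjunction, which hides the field structure.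
   Unfolding 1 would turn the index set {1..n} into {Suc 0..n}. *)
declare add_bit_eq_xor [simp del] mult_bit_eq_and [simp del] One_nat_def [simp del]

lemma bit_add_self [simp]: "a + a = (0 :: bit)"
  by (cases a) simp_all

lemma bit_add_self_left [simp]: "a + (a + b) = (b :: bit)"
  by (simp flip: add.assoc)

lemma bit_add_eq_0_iff [simp]: "a + b = 0 \<longleftrightarrow> a = (b :: bit)"
  by (cases a; cases b) simp_all

lemma bit_sum_eq_of_nat_card:
  fixes f :: "'a \<Rightarrow> bit"
  assumes "finite I"
  shows "(\<Sum>i\<in>I. f i) = of_nat (card {i \<in> I. f i = 1})"
proof -
  have "(\<Sum>i\<in>I. f i) = (\<Sum>i\<in>I. of_bool (f i = 1))"
    by (rule sum.cong) (auto simp: of_bool_def intro: bit.exhaust)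
  also have "\<dots> = of_nat (card {i \<in> I. f i = 1})"
    using assms by (simp add: sum.If_cases of_bool_def Int_def)
  finally show ?thesis .
qed

lemma of_nat_bit_eq_0_iff: "of_nat k = (0 :: bit) \<longleftrightarrow> even k"
  by (induction k) auto

section \<open>Semidirect products, images and kernels\<close>

lemma semidirect_group:
  assumes "group N" and "group K"
    and hom: "\<And>k. k \<in> carrier K \<Longrightarrow> \<phi> k \<in> hom N N"
    and comp: "\<And>k l a. \<lbrakk>k \<in> carrier K; l \<in> carrier K; a \<in> carrier N\<rbrakk>
                 \<Longrightarrow> \<phi> (k \<otimes>\<^bsub>K\<^esub> l) a = \<phi> k (\<phi> l a)"
    and one: "\<And>a. a \<in> carrier N \<Longrightarrow> \<phi> \<one>\<^bsub>K\<^esub> a = a"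
  shows "group (semidirect N \<phi> K)"
proof -
  interpret N: group N by fact
  interpret K: group K by fact
  have cl [simp]: "\<phi> k a \<in> carrier N" if "k \<in> carrier K" "a \<in> carrier N" for k a
    using hom[OF that(1)] that(2) by (auto simp: hom_def)
  have mult: "\<phi> k (a \<otimes>\<^bsub>N\<^esub> b) = \<phi> k a \<otimes>\<^bsub>N\<^esub> \<phi> k b"
    if "k \<in> carrier K" "a \<in> carrier N" "b \<in> carrier N" for k a b
    using hom[OF that(1)] that by (auto simp: hom_def)
  have inv: "\<exists>b\<in>carrier N. \<exists>l\<in>carrier K. b \<otimes>\<^bsub>N\<^esub> \<phi> l a = \<one>\<^bsub>N\<^esub> \<and> l \<otimes>\<^bsub>K\<^esub> k = \<one>\<^bsub>K\<^esub>"
    if "a \<in> carrier N" "k \<in> carrier K" for a k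
    using that by (intro bexI[of _ "inv\<^bsub>N\<^esub> \<phi> (inv\<^bsub>K\<^esub> k) a"] bexI[of _ "inv\<^bsub>K\<^esub> k"]) auto
  show ?thesis
    by (rule groupI)
       (use inv in \<open>auto simp: semidirect_def mult comp one N.m_assoc K.m_assoc\<close>)
qed

text \<open>Used to see that a semidirect product with a quotient is a group without checking that the action descends
  to an action by automorphisms.\<close>

lemma group_hom_image:
  assumes "group G" and "h \<in> hom G H" and "h ` carrier G = carrier H" and "h \<one>\<^bsub>G\<^esub> = \<one>\<^bsub>H\<^esub>"
  shows "group H"
proof -
  have "H\<lparr>carrier := h ` carrier G, one := h \<one>\<^bsub>G\<^esub>\<rparr> = H"
    using assms(3,4) by simp
  then show ?thesis
    using group.hom_imp_img_group[OF assms(1,2)] by simp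
qed

text \<open>Both groups are the quotient of the common source by the common kernel.\<close>

lemma iso_if_same_kernel:
  assumes "group_hom G H h" and "h ` carrier G = carrier H"
    and "group_hom G H' h'" and "h' ` carrier G = carrier H'"
    and "kernel G H h = kernel G H' h'"
  shows "H \<cong> H'"
proof -
  have "G Mod kernel G H h \<cong> H" "G Mod kernel G H h \<cong> H'"
    using group_hom.FactGroup_iso[OF assms(1,2)] group_hom.FactGroup_iso[OF assms(3,4)] assms(5)
    by simp_all
  moreover have "group (G Mod kernel G H h)"
    using group_hom.normal_kernel[OF assms(1)] by (rule normal.factorgroup_is_group)
  ultimately show ?thesis
    using group.iso_sym iso_trans by blast
qed

lemma order_kernel_image:
  assumes "group_hom G H h" and "h ` carrier G = carrier H"
  shows "order H * card (kernel G H h) = order G"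
proof -
  interpret group_hom G H h by fact
  have "order (G Mod kernel G H h) = order H"
    using FactGroup_iso[OF assms(2)] iso_same_card unfolding order_def is_iso_def by blast
  then show ?thesis
    using G.lagrange[OF subgroup_kernel] by (simp add: order_def FactGroup_def)
qed

text \<open>An action of a group on \<open>S\<close> consists of bijections, because inverse group elements act
  inversely. This reduces the construction of a permutation representation to pointwise laws.\<close>

lemma hom_BijGroupI:
  assumes "group G"
    and ext: "\<And>g. g \<in> carrier G \<Longrightarrow> f g \<in> extensional S"
    and cl: "\<And>g x. \<lbrakk>g \<in> carrier G; x \<in> S\<rbrakk> \<Longrightarrow> f g x \<in> S"
    and one: "\<And>x. x \<in> S \<Longrightarrow> f \<one>\<^bsub>G\<^esub> x = x"
    and comp: "\<And>g h x. \<lbrakk>g \<in> carrier G; h \<in> carrier G; x \<in> S\<rbrakk> \<Longrightarrow> f (g \<otimes>\<^bsub>G\<^esub> h) x = f g (f h x)"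
  shows "f \<in> hom G (BijGroup S)"
proof -
  interpret group G by fact
  have Bij: "f g \<in> Bij S" if g: "g \<in> carrier G" for g
  proof -
    have "bij_betw (f g) S S"
    proof (rule bij_betw_byWitness[where f' = "f (inv\<^bsub>G\<^esub> g)"])
      show "\<forall>x\<in>S. f (inv\<^bsub>G\<^esub> g) (f g x) = x" "\<forall>x\<in>S. f g (f (inv\<^bsub>G\<^esub> g) x) = x"
        using g by (simp_all add: one flip: comp)
    qed (use g cl in auto)
    then show ?thesis
      using ext[OF g] by (simp add: Bij_def)
  qed
  moreover have "f (g \<otimes>\<^bsub>G\<^esub> h) = compose S (f g) (f h)" if "g \<in> carrier G" "h \<in> carrier G" for g h
    using that by (intro extensionalityI[of _ S]) (simp_all add: ext comp compose_eq)
  ultimately show ?thesis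
    by (auto simp: hom_def BijGroup_def)
qed

section \<open>Vectors of even weight and permutations of coordinates\<close>

definition perp :: "nat \<Rightarrow> (nat \<Rightarrow> bit) set" where
  "perp n = {v \<in> states n. (\<Sum>i = 1..n. v i) = 0}"

lemma states_eqI:
  assumes "v \<in> states n" "w \<in> states n" "\<And>i. i \<in> {1..n} \<Longrightarrow> v i = w i"
  shows "v = w"
  using assms unfolding states_def by (rule PiE_ext)

lemma restrict_in_states [simp]: "(\<lambda>i\<in>{1..n}. f i) \<in> states n"
  by (simp add: states_def)

lemma carrier_Z2_power: "carrier (Z2_power n) = states n"
  by (simp add: Z2_power_def Z2_group_def states_def)

lemma carrier_perp_ones [simp]: "carrier (perp_ones n) = perp n"
  by (simp add: perp_ones_def perp_def carrier_Z2_power)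

lemma mult_perp_ones [simp]: "c \<otimes>\<^bsub>perp_ones n\<^esub> d = (\<lambda>i\<in>{1..n}. c i + d i)"
  by (simp add: perp_ones_def Z2_power_def Z2_group_def)

lemma one_perp_ones [simp]: "\<one>\<^bsub>perp_ones n\<^esub> = (\<lambda>i\<in>{1..n}. 0)"
  by (simp add: perp_ones_def Z2_power_def Z2_group_def)

lemma perp_states: "c \<in> perp n \<Longrightarrow> c \<in> states n"
  by (simp add: perp_def)

lemma perp_ones_group: "group (perp_ones n)"
proof (rule groupI)
  fix x y z
  assume "x \<in> carrier (perp_ones n)" "y \<in> carrier (perp_ones n)" "z \<in> carrier (perp_ones n)"
  then show "x \<otimes>\<^bsub>perp_ones n\<^esub> y \<in> carrier (perp_ones n)"
    and "x \<otimes>\<^bsub>perp_ones n\<^esub> y \<otimes>\<^bsub>perp_ones n\<^esub> z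
       = x \<otimes>\<^bsub>perp_ones n\<^esub> (y \<otimes>\<^bsub>perp_ones n\<^esub> z)"
    and "\<one>\<^bsub>perp_ones n\<^esub> \<otimes>\<^bsub>perp_ones n\<^esub> x = x"
    and "\<exists>x'\<in>carrier (perp_ones n). x' \<otimes>\<^bsub>perp_ones n\<^esub> x = \<one>\<^bsub>perp_ones n\<^esub>"
    by (auto simp: perp_def sum.distrib add.assoc intro!: states_eqI[of _ n] bexI[of _ x])
qed (simp add: perp_def)

lemma perp_zero [simp]: "(\<lambda>i\<in>{1..n}. 0) \<in> perp n"
  by (simp add: perp_def)

lemma ones_perp: "even n \<Longrightarrow> ones n \<in> perp n"
  by (simp add: perp_def ones_def of_nat_bit_eq_0_iff)

lemma coord_action_states [simp]:
  assumes "p permutes {1..n}" "v \<in> states n"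
  shows "coord_action p v \<in> states n"
proof -
  have "inv' p i \<in> {1..n} \<longleftrightarrow> i \<in> {1..n}" for i
    using permutes_in_image[OF permutes_inv[OF assms(1)]] .
  then show ?thesis
    using assms(2) by (auto simp: coord_action_def states_def PiE_iff extensional_def)
qed

lemma sum_coord_action:
  assumes "p permutes {1..n}"
  shows "(\<Sum>i = 1..n. f (coord_action p v i)) = (\<Sum>i = 1..n. f (v i))"
  using sum.permute[OF permutes_inv[OF assms], of "\<lambda>i. f (v i)"]
  by (simp add: coord_action_def o_def)

lemma coord_action_perp [simp]:
  assumes "p permutes {1..n}" "v \<in> perp n"
  shows "coord_action p v \<in> perp n"
  using assms sum_coord_action[OF assms(1), of "\<lambda>x. x"] by (simp add: perp_def)

lemma coord_action_comp:
  assumes "p permutes A" "q permutes A"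
  shows "coord_action (p \<circ> q) v = coord_action p (coord_action q v)"
  using assms by (simp add: coord_action_def o_inv_distrib permutes_bij comp_assoc)

lemma coord_action_id [simp]: "coord_action id v = v"
  by (simp add: coord_action_def)

text \<open>Permuting coordinates commutes with every coordinatewise operation; the cases that matter are addition and
  \<open>a + n b\<close>.\<close>

lemma coord_action_pointwise:
  assumes "p permutes {1..n}"
  shows "coord_action p (\<lambda>i\<in>{1..n}. f (v i) (w i))
    = (\<lambda>i\<in>{1..n}. f (coord_action p v i) (coord_action p w i))"
  using permutes_in_image[OF permutes_inv[OF assms]]
  by (auto simp: coord_action_def restrict_def)

lemma coord_action_const:
  assumes "p permutes {1..n}"
  shows "coord_action p (\<lambda>i\<in>{1..n}. b) = (\<lambda>i\<in>{1..n}. b)"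
  using coord_action_pointwise[OF assms, of "\<lambda>_ _. b"] by simp

abbreviation perp_sym :: "nat \<Rightarrow> ((nat \<Rightarrow> bit) \<times> (nat \<Rightarrow> nat)) monoid" where
  "perp_sym n \<equiv> semidirect (perp_ones n) coord_action (sym_group n)"

lemma perp_sym_group: "group (perp_sym n)"
proof (rule semidirect_group)
  fix p assume "p \<in> carrier (sym_group n)"
  then show "coord_action p \<in> hom (perp_ones n) (perp_ones n)"
    by (auto simp: hom_def sym_group_def coord_action_pointwise[where f = "(+)"])
qed (auto simp: perp_ones_group sym_group_is_group sym_group_carrier sym_group_mult sym_group_one
    coord_action_comp)

lemma carrier_perp_sym [simp]: "carrier (perp_sym n) = perp n \<times> {p. p permutes {1..n}}"
  by (simp add: semidirect_def sym_group_def)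

lemma mult_perp_sym [simp]:
  "(c, p) \<otimes>\<^bsub>perp_sym n\<^esub> (d, q) = (\<lambda>i\<in>{1..n}. c i + coord_action p d i, p \<circ> q)"
  by (simp add: semidirect_def sym_group_def)

lemma one_perp_sym [simp]: "\<one>\<^bsub>perp_sym n\<^esub> = (\<lambda>i\<in>{1..n}. 0, id)"
  by (simp add: semidirect_def sym_group_def)

text \<open>Flipping the first coordinate exchanges vectors of even and odd weight, so each kind makes up half of the
  \<open>2\<^sup>n\<close> vectors.\<close>

lemma card_perp:
  assumes "n > 0"
  shows "card (perp n) = 2 ^ (n - 1)"
proof -
  let ?odd = "states n - perp n" and ?f = "\<lambda>v :: nat \<Rightarrow> bit. v(1 := v 1 + 1)"
  have fin: "finite (states n)" and card: "card (states n) = 2 ^ n"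
  proof -
    have UNIV: "(UNIV :: bit set) = {0, 1}" using bit.exhaust by auto
    have "finite (UNIV :: bit set)" "card (UNIV :: bit set) = 2"
      unfolding UNIV by simp_all
    then show "finite (states n)" "card (states n) = 2 ^ n"
      by (auto simp: states_def card_PiE intro!: finite_PiE)
  qed
  have sum: "(\<Sum>i = 1..n. ?f v i) = (\<Sum>i = 1..n. v i) + 1" for v
  proof -
    have "(\<Sum>i = 1..n. ?f v i) = (\<Sum>i = 1..n. v i + of_bool (i = 1))"
      by (rule sum.cong) auto
    then show ?thesis using assms by (simp add: sum.distrib of_bool_def sum.If_cases)
  qed
  have st: "?f v \<in> states n" if "v \<in> states n" for v
    using that assms by (auto simp: states_def PiE_iff extensional_def)
  have f: "?f v \<in> perp n \<longleftrightarrow> v \<notin> perp n" if "v \<in> states n" for v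
    using st[OF that] that unfolding perp_def mem_Collect_eq sum by simp
  have "bij_betw ?f (perp n) ?odd"
  proof (rule bij_betw_byWitness[where f' = ?f])
    show "\<forall>v\<in>perp n. ?f (?f v) = v" "\<forall>v\<in>?odd. ?f (?f v) = v"
      by (simp_all add: add.assoc)
    show "?f ` perp n \<subseteq> ?odd" "?f ` ?odd \<subseteq> perp n"
      using st f perp_states by blast+
  qed
  then have "card (perp n) = card ?odd" by (rule bij_betw_same_card)
  also have "\<dots> = 2 ^ n - card (perp n)"
    using fin by (subst card_Diff_subset) (auto simp: card dest: perp_states intro: finite_subset[OF _ fin])
  finally have "card (perp n) = 2 ^ n - card (perp n)" .
  moreover have "card (perp n) \<le> 2 ^ n"
    unfolding card[symmetric] by (rule card_mono[OF fin]) (auto dest: perp_states)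
  ultimately have "2 * card (perp n) = 2 ^ n" by linarith
  also have "(2 :: nat) ^ n = 2 * 2 ^ (n - 1)"
    using assms by (cases n) auto
  finally show ?thesis by simp
qed

lemma order_perp_sym: "n > 0 \<Longrightarrow> order (perp_sym n) = 2 ^ (n - 1) * fact n"
  by (simp add: order_def card_cartesian_product card_perp card_permutations)

section \<open>Half the weight as a quadratic form\<close>

definition weight :: "nat \<Rightarrow> (nat \<Rightarrow> bit) \<Rightarrow> nat" where
  "weight n c = card {i \<in> {1..n}. c i = 1}"

definition dot :: "nat \<Rightarrow> (nat \<Rightarrow> bit) \<Rightarrow> (nat \<Rightarrow> bit) \<Rightarrow> bit" where
  "dot n c w = (\<Sum>i = 1..n. c i * w i)"

text \<open>Modulo 2 this is the second elementary symmetric function of the entries of \<open>c\<close>, hence a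
  quadratic form.\<close>

definition half_weight :: "nat \<Rightarrow> (nat \<Rightarrow> bit) \<Rightarrow> bit" where
  "half_weight n c = of_nat (weight n c div 2)"

lemma even_weight: "c \<in> perp n \<Longrightarrow> even (weight n c)"
  by (simp add: perp_def weight_def bit_sum_eq_of_nat_card of_nat_bit_eq_0_iff)

text \<open>The weights satisfy \<open>|c + d| = |c| + |d| - 2 |c \<inter> d|\<close> for the supports. Since all
  weights are even, this can be halved, and \<open>|c \<inter> d|\<close> reduces modulo 2 to the scalar
  product.\<close>

lemma half_weight_add:
  assumes "c \<in> perp n" "d \<in> perp n"
  shows "half_weight n (\<lambda>i\<in>{1..n}. c i + d i) = half_weight n c + half_weight n d + dot n c d"
proof -
  let ?C = "{i \<in> {1..n}. c i = 1}" and ?D = "{i \<in> {1..n}. d i = 1}"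
  let ?s = "\<lambda>i\<in>{1..n}. c i + d i"
  have s: "weight n ?s = card (?C - ?D) + card (?D - ?C)"
  proof -
    have "{i \<in> {1..n}. ?s i = 1} = (?C - ?D) \<union> (?D - ?C)"
    proof (rule Set.set_eqI)
      fix i
      show "i \<in> {i \<in> {1..n}. ?s i = 1} \<longleftrightarrow> i \<in> (?C - ?D) \<union> (?D - ?C)"
        by (cases "c i"; cases "d i") auto
    qed
    then show ?thesis
      unfolding weight_def by (simp only:) (rule card_Un_disjoint; auto)
  qed
  have C: "weight n c = card (?C \<inter> ?D) + card (?C - ?D)"
    unfolding weight_def by (rule card_Int_Diff) simp
  have D: "weight n d = card (?C \<inter> ?D) + card (?D - ?C)"
    unfolding weight_def by (subst Int_commute, rule card_Int_Diff) simp
  have dot: "dot n c d = of_nat (card (?C \<inter> ?D))"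
  proof -
    have "c i * d i = 1 \<longleftrightarrow> c i = 1 \<and> d i = 1" for i
      by (cases "c i"; cases "d i") simp_all
    then have "{i \<in> {1..n}. c i * d i = 1} = ?C \<inter> ?D"
      by auto
    then show ?thesis
      unfolding dot_def by (simp add: bit_sum_eq_of_nat_card)
  qed
  have half: "(a + b) div 2 + k = (k + a) div 2 + (k + b) div 2"
    if "even (k + a)" "even (k + b)" for a b k :: nat
  proof -
    have "(a + b) div 2 + k = ((k + a) + (k + b)) div 2" by simp
    also have "\<dots> = (k + a) div 2 + (k + b) div 2" using that by (intro div_plus_div_distrib_dvd_left)
    finally show ?thesis .
  qed
  have "weight n ?s div 2 + card (?C \<inter> ?D) = weight n c div 2 + weight n d div 2"
    using assms[THEN even_weight] unfolding s C D by (rule half)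
  then have "half_weight n ?s + dot n c d = half_weight n c + half_weight n d"
    unfolding half_weight_def dot by (simp only: flip: of_nat_add)
  then have "half_weight n ?s + dot n c d + dot n c d = half_weight n c + half_weight n d + dot n c d"
    by (rule arg_cong)
  then show ?thesis
    by (simp add: add.assoc)
qed

lemma half_weight_coord_action:
  assumes "p permutes {1..n}"
  shows "half_weight n (coord_action p c) = half_weight n c"
proof -
  have "bij_betw p {i \<in> {1..n}. c i = 1} {i \<in> {1..n}. coord_action p c i = 1}"
    using permutes_in_image[OF assms] permutes_in_image[OF permutes_inv[OF assms]] permutes_inverses[OF assms]
    by (intro bij_betw_byWitness[where f' = "inv' p"]) (auto simp: coord_action_def)
  then show ?thesis
    by (simp add: half_weight_def weight_def bij_betw_same_card)
qed

lemma dot_coord_action: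
  assumes "p permutes {1..n}"
  shows "dot n (coord_action p c) (coord_action p w) = dot n c w"
  using sum.permute[OF permutes_inv[OF assms], of "\<lambda>i. c i * w i"]
  by (simp add: dot_def coord_action_def o_def)

lemma dot_commute: "dot n c w = dot n w c"
  by (simp add: dot_def mult.commute)

lemma dot_add_right: "dot n c (\<lambda>i\<in>{1..n}. v i + w i) = dot n c v + dot n c w"
  by (simp add: dot_def distrib_left sum.distrib)

lemma dot_add_left: "dot n (\<lambda>i\<in>{1..n}. v i + w i) c = dot n v c + dot n w c"
  by (simp add: dot_def distrib_right sum.distrib)

lemma dot_zero_left [simp]: "dot n (\<lambda>i\<in>{1..n}. 0) w = 0"
  by (simp add: dot_def)

lemma half_weight_zero [simp]: "half_weight n (\<lambda>i\<in>{1..n}. 0) = 0"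
proof -
  have "{i \<in> {1..n}. (\<lambda>i\<in>{1..n}. 0 :: bit) i = 1} = {}" by auto
  then show ?thesis
    unfolding half_weight_def weight_def by (simp only:) simp
qed

definition unit_pair :: "nat \<Rightarrow> nat \<Rightarrow> nat \<Rightarrow> nat \<Rightarrow> bit" where
  "unit_pair n i j = (\<lambda>k\<in>{1..n}. of_bool (k = i \<or> k = j))"

lemma unit_pair_apply: "k \<in> {1..n} \<Longrightarrow> unit_pair n i j k = of_bool (k = i \<or> k = j)"
  by (simp add: unit_pair_def)

lemma coord_action_unit_pair:
  assumes "p permutes {1..n}"
  shows "coord_action p (unit_pair n i j) = unit_pair n (p i) (p j)"
proof -
  have "inv' p k = l \<longleftrightarrow> k = p l" for k l
    using permutes_inverses[OF assms] by metis
  then show ?thesis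
    using permutes_in_image[OF permutes_inv[OF assms]]
    by (auto simp: coord_action_def unit_pair_def fun_eq_iff)
qed

lemma dot_unit_pair:
  assumes "i \<in> {1..n}" "j \<in> {1..n}" "i \<noteq> j"
  shows "dot n (unit_pair n i j) w = w i + w j"
proof -
  have "dot n (unit_pair n i j) w = (\<Sum>k = 1..n. (if k = i then w k else 0) + (if k = j then w k else 0))"
    unfolding dot_def using assms by (intro sum.cong) (auto simp: unit_pair_def)
  then show ?thesis using assms by (simp add: sum.distrib)
qed

lemma unit_pair_perp:
  assumes "i \<in> {1..n}" "j \<in> {1..n}" "i \<noteq> j"
  shows "unit_pair n i j \<in> perp n"
  using dot_unit_pair[OF assms, of "\<lambda>_. 1"] by (simp add: perp_def dot_def) (simp add: unit_pair_def)

lemma half_weight_unit_pair: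
  assumes "i \<in> {1..n}" "j \<in> {1..n}" "i \<noteq> j"
  shows "half_weight n (unit_pair n i j) = 1"
proof -
  have "{k \<in> {1..n}. unit_pair n i j k = 1} = {i, j}"
    using assms by (auto simp: unit_pair_def)
  then show ?thesis
    using assms by (simp add: half_weight_def weight_def)
qed

section \<open>States as sequences of differences\<close>

text \<open>The first component lists the differences of neighbouring entries, each shifted by the parity of its
  position; the differences sum to zero around the circle, which fixes the coordinate sum.\<close>

definition codes :: "nat \<Rightarrow> ((nat \<Rightarrow> bit) \<times> bit) set" where
  "codes n = {w \<in> states n. (\<Sum>i = 1..n. w i) = (\<Sum>i = 1..n. of_nat i)} \<times> UNIV"

definition encode :: "nat \<Rightarrow> (nat \<Rightarrow> bit) \<Rightarrow> (nat \<Rightarrow> bit) \<times> bit" where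
  "encode n y = (\<lambda>i\<in>{1..n}. y (cyc_pred n i) + y i + of_nat i, y n)"

definition decode :: "nat \<Rightarrow> (nat \<Rightarrow> bit) \<times> bit \<Rightarrow> (nat \<Rightarrow> bit)" where
  "decode n = (\<lambda>(w, t). \<lambda>k\<in>{1..n}. t + (\<Sum>i = 1..k. w i + of_nat i))"

lemma decode_in_states: "decode n x \<in> states n"
  by (simp add: decode_def split: prod.split)

text \<open>The cyclic predecessor permutes the positions.\<close>

lemma sum_cyc_pred:
  assumes "n > 0"
  shows "(\<Sum>i = 1..n. y (cyc_pred n i)) = (\<Sum>i = 1..n. y i)"
proof -
  have "bij_betw (cyc_pred n) {1..n} {1..n}"
    using assms by (intro bij_betw_byWitness[where f' = "cyc_succ n"])
      (auto simp: cyc_pred_def cyc_succ_def)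
  then show ?thesis by (rule sum.reindex_bij_betw)
qed

lemma encode_in_codes:
  assumes "n > 0"
  shows "encode n y \<in> codes n"
  using sum_cyc_pred[OF assms, of y] by (simp add: encode_def codes_def sum.distrib)

text \<open>The partial sums of the differences telescope to \<open>y\<^sub>n + y\<^sub>k\<close>.\<close>

lemma decode_encode:
  assumes "y \<in> states n"
  shows "decode n (encode n y) = y"
proof (rule states_eqI)
  fix k assume k: "k \<in> {1..n}"
  have "k \<le> n \<Longrightarrow> k \<ge> 1 \<Longrightarrow> (\<Sum>i = 1..k. (\<lambda>i\<in>{1..n}. y (cyc_pred n i) + y i + of_nat i) i + of_nat i) = y n + y k" for k
  proof (induction k)
    case (Suc k)
    then show ?case
      by (cases "k = 0") (auto simp: cyc_pred_def add.assoc)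
  qed simp
  then show "decode n (encode n y) k = y k"
    using k by (simp add: decode_def encode_def)
qed (use assms in \<open>simp_all add: decode_def encode_def\<close>)

text \<open>At position 1 the predecessor is \<open>n\<close>, and the full sum of the differences must vanish for the
  reconstruction to close up; this is where the prescribed coordinate sum enters.\<close>

lemma encode_decode:
  assumes "n > 0" "x \<in> codes n"
  shows "encode n (decode n x) = x"
proof -
  obtain w t where x: "x = (w, t)" by (cases x)
  then have w: "w \<in> states n" "(\<Sum>i = 1..n. w i + of_nat i) = 0"
    using assms by (simp_all add: codes_def sum.distrib)
  have "(\<lambda>i\<in>{1..n}. decode n x (cyc_pred n i) + decode n x i + of_nat i) = w"
  proof (rule states_eqI[of _ n])
    fix i assume i: "i \<in> {1..n}"
    show "(\<lambda>i\<in>{1..n}. decode n x (cyc_pred n i) + decode n x i + of_nat i) i = w i"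
    proof (cases "i = 1")
      case True
      then show ?thesis
        using i w by (simp add: x decode_def cyc_pred_def add.assoc)
    next
      case False
      then obtain k where k: "i = Suc k" "k \<ge> 1" "k \<in> {1..n}" "k \<noteq> 0" using i by (cases i) auto
      then show ?thesis
        using i w by (simp add: x decode_def cyc_pred_def add_ac)
    qed
  qed (use w in simp_all)
  moreover have "decode n x n = t" using w assms(1) by (simp add: x decode_def)
  ultimately show ?thesis by (simp add: encode_def x)
qed

section \<open>The action of the semidirect product on states\<close>

text \<open>Only the parity of \<open>n\<close> enters. For even \<open>n\<close> the vector \<open>c\<close> acts as
  a functional on \<open>w\<close>; for odd \<open>n\<close> it also translates \<open>w\<close>, and the term with
  \<open>half_weight\<close> corrects the failure of the functional alone to be compatible with composition.\<close>

definition act :: "nat \<Rightarrow> (nat \<Rightarrow> bit) \<times> (nat \<Rightarrow> nat) \<Rightarrow> (nat \<Rightarrow> bit) \<times> bit \<Rightarrow> (nat \<Rightarrow> bit) \<times> bit" where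
  "act n = (\<lambda>(c, p) (w, t).
    (\<lambda>i\<in>{1..n}. coord_action p w i + of_nat n * c i,
     t + dot n c (coord_action p w) + of_nat n * half_weight n c))"

lemma act_in_codes:
  assumes "c \<in> perp n" "p permutes {1..n}" "x \<in> codes n"
  shows "act n (c, p) x \<in> codes n"
  using assms sum_coord_action[OF assms(2), of "\<lambda>x. x"]
  by (cases x) (simp add: act_def codes_def perp_def sum.distrib flip: sum_distrib_left)

lemma act_id:
  assumes "x \<in> codes n"
  shows "act n (\<lambda>i\<in>{1..n}. 0, id) x = x"
  using assms by (cases x) (auto simp: act_def codes_def intro!: states_eqI[of _ n])

text \<open>Translating \<open>w\<close> by \<open>n d\<close> first contributes an extra
  \<open>n \<langle>c, d\<rangle>\<close> to the functional of \<open>c\<close>. This is exactly the polarization term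
  of the quadratic form.\<close>

lemma act_comp:
  assumes "c \<in> perp n" "d \<in> perp n" and p: "p permutes {1..n}" and q: "q permutes {1..n}"
  shows "act n ((c, p) \<otimes>\<^bsub>perp_sym n\<^esub> (d, q)) x = act n (c, p) (act n (d, q) x)"
proof -
  obtain w t where x: "x = (w, t)" by (cases x)
  let ?n = "of_nat n :: bit"
  let ?d = "coord_action p d" and ?w = "coord_action (p \<circ> q) w"
  have pqw: "coord_action p (coord_action q w) = ?w"
    using coord_action_comp[OF p q] by simp
  have shifted: "coord_action p (\<lambda>i\<in>{1..n}. coord_action q w i + ?n * d i)
      = (\<lambda>i\<in>{1..n}. ?w i + ?n * ?d i)"
    using coord_action_pointwise[OF p, of "\<lambda>a b. a + ?n * b" "coord_action q w" d]
    by (simp add: pqw)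
  have "dot n c (\<lambda>i\<in>{1..n}. ?w i + ?n * ?d i) = dot n c ?w + ?n * dot n c ?d"
    by (simp add: dot_def distrib_left sum.distrib sum_distrib_left mult.left_commute)
  moreover have "dot n d (coord_action q w) = dot n ?d ?w"
    using dot_coord_action[OF p, of d "coord_action q w"] by (simp add: pqw)
  moreover have "half_weight n (\<lambda>i\<in>{1..n}. c i + ?d i) = half_weight n c + half_weight n d + dot n c ?d"
    using half_weight_add[OF assms(1) coord_action_perp[OF p assms(2)]] half_weight_coord_action[OF p]
    by simp
  ultimately show ?thesis
    by (auto simp: act_def x shifted dot_add_left distrib_left add_ac)
qed

definition state_perm :: "nat \<Rightarrow> (nat \<Rightarrow> bit) \<times> (nat \<Rightarrow> nat) \<Rightarrow> (nat \<Rightarrow> bit) \<Rightarrow> (nat \<Rightarrow> bit)" where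
  "state_perm n g = (\<lambda>y\<in>states n. decode n (act n g (encode n y)))"

lemma state_perm_hom:
  assumes "n > 0"
  shows "state_perm n \<in> hom (perp_sym n) (BijGroup (states n))"
proof (rule hom_BijGroupI[OF perp_sym_group])
  fix y assume y: "y \<in> states n"
  show "state_perm n \<one>\<^bsub>perp_sym n\<^esub> y = y"
    using y assms by (simp add: state_perm_def act_id encode_in_codes decode_encode)
  fix g h assume g: "g \<in> carrier (perp_sym n)" and h: "h \<in> carrier (perp_sym n)"
  obtain c p d q where gh: "g = (c, p)" "h = (d, q)" by (cases g, cases h)
  show "state_perm n (g \<otimes>\<^bsub>perp_sym n\<^esub> h) y = state_perm n g (state_perm n h y)"
    using g h y assms unfolding gh
    by (simp add: state_perm_def act_comp decode_in_states encode_decode act_in_codes encode_in_codes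
          del: mult_perp_sym)
qed (auto simp: state_perm_def decode_in_states)

section \<open>The local updates as images of generators\<close>

text \<open>Preimages of the local updates: position \<open>n\<close> is the one where the wrap-around requires a
  nonzero vector.\<close>

definition generator :: "nat \<Rightarrow> nat \<Rightarrow> (nat \<Rightarrow> bit) \<times> (nat \<Rightarrow> nat)" where
  "generator n i = (if i = n then (unit_pair n 1 n, transpose 1 n)
                    else (\<lambda>k\<in>{1..n}. 0, transpose i (i + 1)))"

lemma generator_in_carrier:
  assumes "n > 1" "i \<in> {1..n}"
  shows "generator n i \<in> carrier (perp_sym n)"
  using assms by (auto simp: generator_def unit_pair_perp intro!: permutes_swap_id)

lemma coord_action_transpose: "coord_action (transpose a b) w k = w (transpose a b k)"
  by (simp add: coord_action_def)

text \<open>The computation behind the choice of coordinates: away from \<open>n\<close> an update interchanges two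
  neighbouring entries and keeps \<open>y\<^sub>n\<close>; at \<open>n\<close> the functional of the pair contributes
  \<open>w\<^sub>1 + w\<^sub>n\<close>, and the half weight of a pair, which is 1, cancels the shift by
  \<open>n\<close> contained in \<open>w\<^sub>n\<close>.\<close>

lemma act_generator_encode:
  assumes "n > 2" "i \<in> {1..n}" "y \<in> states n"
  shows "act n (generator n i) (encode n y) = encode n (update105 n i y)"
proof (cases "i = n")
  case True
  show ?thesis
    using assms unfolding True
    by (auto simp: act_def generator_def encode_def update105_def coord_action_transpose
        dot_unit_pair half_weight_unit_pair cyc_pred_def cyc_succ_def unit_pair_apply fun_eq_iff
        transpose_def add_ac)
next
  case False
  then show ?thesis
    using assms
    by (auto simp: act_def generator_def encode_def update105_def coord_action_transpose
        cyc_pred_def cyc_succ_def fun_eq_iff transpose_def add_ac simp flip: One_nat_def)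
qed

lemma state_perm_generator:
  assumes "n > 2" "i \<in> {1..n}"
  shows "state_perm n (generator n i) = update105 n i"
proof (rule extensionalityI)
  fix y assume y: "y \<in> states n"
  have "update105 n i y \<in> states n"
    using y assms by (auto simp: update105_def states_def PiE_iff extensional_def)
  then show "state_perm n (generator n i) y = update105 n i y"
    using act_generator_encode[OF assms y] y by (simp add: state_perm_def decode_encode)
qed (simp_all add: state_perm_def update105_def)

section \<open>Generation of the semidirect product\<close>

text \<open>The symmetric group is doubly transitive; this moves one pair of positions to every other one.\<close>

lemma permutes_mapping_pair:
  assumes "a \<in> A" "b \<in> A" "a \<noteq> b" "i \<in> A" "j \<in> A" "i \<noteq> j"
  obtains p where "p permutes A" "p a = i" "p b = j"
proof
  define b' where "b' = transpose a i b"
  have b': "b' \<in> A" "b' \<noteq> i"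
    using assms by (auto simp: b'_def transpose_def)
  show "transpose b' j \<circ> transpose a i permutes A"
    using assms b' by (intro permutes_compose permutes_swap_id)
  show "(transpose b' j \<circ> transpose a i) a = i"
    using assms b' by (simp add: transpose_def)
  show "(transpose b' j \<circ> transpose a i) b = j"
    by (simp add: b'_def)
qed

text \<open>A transposition of distant positions is conjugate, by a shorter one, to an adjacent transposition.\<close>

lemma transposition_in_closure:
  fixes i j n :: nat
  assumes comp: "\<And>p q. \<lbrakk>p \<in> M; q \<in> M\<rbrakk> \<Longrightarrow> p \<circ> q \<in> M"
    and adj: "\<And>i. \<lbrakk>1 \<le> i; i < n\<rbrakk> \<Longrightarrow> transpose i (i + 1) \<in> M"
    and "1 \<le> i" "i < j" "j \<le> n"
  shows "transpose i j \<in> M"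
  using \<open>i < j\<close> \<open>j \<le> n\<close>
proof (induction j rule: less_induct)
  case (less j)
  then obtain k where j: "j = k + 1" by (cases j) auto
  show ?case
  proof (cases "i = k")
    case True
    then show ?thesis using adj[of i] less.prems \<open>1 \<le> i\<close> by (simp add: j)
  next
    case False
    then have ik: "i < k" using less.prems j by simp
    then have t: "transpose i k \<in> M" "transpose k (k + 1) \<in> M"
      using less.IH[of k] adj[of k] less.prems j \<open>1 \<le> i\<close> by auto
    have "transpose i k \<circ> transpose k (k + 1) \<circ> transpose i k = transpose i j"
      using ik by (simp add: j transpose_comp_triple)
    then show ?thesis using comp t by metis
  qed
qed

lemma permutation_in_closure:
  fixes n :: nat
  assumes comp: "\<And>p q. \<lbrakk>p \<in> M; q \<in> M\<rbrakk> \<Longrightarrow> p \<circ> q \<in> M"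
    and id: "id \<in> M"
    and adj: "\<And>i. \<lbrakk>1 \<le> i; i < n\<rbrakk> \<Longrightarrow> transpose i (i + 1) \<in> M"
    and "p permutes {1..n}"
  shows "p \<in> M"
  using \<open>p permutes {1..n}\<close> finite_atLeastAtMost[of 1 n]
proof (induction rule: permutes_induct)
  case id
  show ?case by fact
next
  case (swap a b p)
  have "transpose a b \<in> M"
  proof (cases "a < b")
    case True
    with swap show ?thesis by (intro transposition_in_closure[OF comp adj]) auto
  next
    case False
    with swap have "transpose b a \<in> M" by (intro transposition_in_closure[OF comp adj]) auto
    then show ?thesis by (simp add: transpose_commute)
  qed
  then show ?case using swap by (intro comp)
qed

text \<open>The adjacent transpositions give all permutations. Cancelling the transposition from the last generator
  leaves a vector supported on two positions, conjugation moves it to every pair of positions, and every vector of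
  even weight is a sum of such pairs.\<close>

lemma generate_generators:
  assumes n: "n > 1"
  shows "generate (perp_sym n) (generator n ` {1..n}) = carrier (perp_sym n)"
proof -
  interpret group "perp_sym n" by (rule perp_sym_group)
  let ?W = "perp_sym n" and ?zero = "\<lambda>i\<in>{1..n}. 0 :: bit"
  let ?H = "generate ?W (generator n ` {1..n})"
  have gens: "generator n ` {1..n} \<subseteq> carrier ?W"
    using generator_in_carrier[OF n] by blast
  have comp: "(\<lambda>i\<in>{1..n}. c i + coord_action p d i, p \<circ> q) \<in> ?H"
    if "(c, p) \<in> ?H" "(d, q) \<in> ?H" for c p d q
    using generate.eng[OF that] by simp
  have perms: "(?zero, p) \<in> ?H" if p: "p permutes {1..n}" for p
  proof -
    let ?M = "{p. p permutes {1..n} \<and> (?zero, p) \<in> ?H}"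
    have "p \<in> ?M"
    proof (rule permutation_in_closure[OF _ _ _ p])
      fix p q assume "p \<in> ?M" "q \<in> ?M"
      then have "p permutes {1..n}" "q permutes {1..n}" and pq: "(?zero, p) \<in> ?H" "(?zero, q) \<in> ?H"
        by blast+
      moreover from this have "(?zero, p \<circ> q) \<in> ?H"
        using comp[OF pq] by (simp add: coord_action_const cong: restrict_cong)
      ultimately show "p \<circ> q \<in> ?M" by (simp add: permutes_compose)
    next
      show "id \<in> ?M"
        using generate.one[of ?W] by (simp add: permutes_id)
    next
      fix i assume i: "1 \<le> i" "i < n"
      then have "generator n i \<in> ?H" by (intro generate.incl) auto
      then show "transpose i (i + 1) \<in> ?M"
        using i by (simp add: generator_def permutes_swap_id)
    qed
    then show ?thesis by blast
  qed
  have carr: "c \<in> perp n" if "(c, p) \<in> ?H" for c p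
    using generate_in_carrier[OF gens that] by simp
  have left: "(coord_action p d, p \<circ> q) \<in> ?H" if p: "p permutes {1..n}" and dq: "(d, q) \<in> ?H" for p d q
  proof -
    have "(\<lambda>i\<in>{1..n}. ?zero i + coord_action p d i) = coord_action p d"
      using carr[OF dq] p by (intro states_eqI[of _ n]) (auto simp: perp_states)
    then show ?thesis using comp[OF perms[OF p] dq] by simp
  qed
  have right: "(c, p \<circ> q) \<in> ?H" if cp: "(c, p) \<in> ?H" and q: "q permutes {1..n}" for c p q
  proof -
    have "p permutes {1..n}" using generate_in_carrier[OF gens cp] by simp
    then have "(\<lambda>i\<in>{1..n}. c i + coord_action p ?zero i) = c"
      using carr[OF cp] by (intro states_eqI[of _ n]) (auto simp: perp_states coord_action_const)
    then show ?thesis using comp[OF cp perms[OF q]] by simp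
  qed
  have pairs: "(unit_pair n i j, id) \<in> ?H" if ij: "i \<in> {1..n}" "j \<in> {1..n}" "i \<noteq> j" for i j
  proof -
    obtain p where p: "p permutes {1..n}" "p 1 = i" "p n = j"
      using permutes_mapping_pair[of 1 "{1..n}" n i j] n ij by auto
    have "generator n n \<in> ?H" using n by (intro generate.incl) auto
    then have g: "(unit_pair n 1 n, transpose 1 n) \<in> ?H" by (simp add: generator_def)
    have "transpose 1 n permutes {1..n}" using n by (intro permutes_swap_id) auto
    then have q: "transpose 1 n \<circ> inv' p permutes {1..n}"
      using p by (intro permutes_compose permutes_inv)
    have "p \<circ> transpose 1 n \<circ> (transpose 1 n \<circ> inv' p) = id"
      using permutes_inverses[OF p(1)] by (simp add: fun_eq_iff)
    then have "(coord_action p (unit_pair n 1 n), id) \<in> ?H"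
      using right[OF left[OF p(1) g] q] by simp
    then show ?thesis
      using p by (simp add: coord_action_unit_pair)
  qed
  have vectors: "(c, id) \<in> ?H" if "c \<in> perp n" for c
    using that
  proof (induction "weight n c" arbitrary: c rule: less_induct)
    case less
    show ?case
    proof (cases "weight n c = 0")
      case True
      then have "c = ?zero"
        using less.prems by (intro states_eqI[of _ n]) (auto simp: weight_def perp_def)
      then show ?thesis using generate.one[of ?W] by simp
    next
      case False
      then obtain i where i: "i \<in> {1..n}" "c i = 1"
        by (auto simp: weight_def)
      have "{k \<in> {1..n}. c k = 1} \<noteq> {i}"
        using even_weight[OF less.prems] by (auto simp: weight_def)
      then obtain j where ij: "i \<in> {1..n}" "c i = 1" "j \<in> {1..n}" "c j = 1" "i \<noteq> j"
        using i by blast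
      let ?d = "\<lambda>k\<in>{1..n}. c k + unit_pair n i j k"
      have d: "?d \<in> perp n"
        using less.prems unit_pair_perp[OF ij(1,3,5)] by (simp add: perp_def sum.distrib)
      have "weight n ?d < weight n c"
        unfolding weight_def
        using ij by (intro psubset_card_mono) (auto simp: unit_pair_apply)
      then have "(?d, id) \<in> ?H" using less.hyps d by blast
      from comp[OF this pairs[OF ij(1,3,5)]]
      have "(\<lambda>k\<in>{1..n}. ?d k + unit_pair n i j k, id) \<in> ?H" by simp
      moreover have "(\<lambda>k\<in>{1..n}. ?d k + unit_pair n i j k) = c"
        using less.prems by (intro states_eqI[of _ n]) (auto simp: add.assoc perp_states)
      ultimately show ?thesis by simp
    qed
  qed
  have "(c, p) \<in> ?H" if "c \<in> perp n" "p permutes {1..n}" for c p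
    using right[OF vectors] that by fastforce
  then show ?thesis
    using generate_incl[OF gens] by auto
qed

section \<open>The kernel of the action\<close>

text \<open>Two consecutive numbers contribute 1 modulo 2.\<close>

lemma sum_of_nat_bit: "(\<Sum>i = 1..2 * m. of_nat i :: bit) = of_nat m"
proof (induction m)
  case (Suc m)
  have "(\<Sum>i = 1..2 * Suc m. of_nat i :: bit)
      = (\<Sum>i = 1..2 * m. of_nat i) + of_nat (2 * m + 1) + of_nat (2 * m + 2)"
    by (simp add: add.assoc)
  then show ?case by (simp add: Suc add.commute)
qed simp

lemma sum_of_nat_bit_eq_0:
  assumes "even n"
  shows "(\<Sum>i = 1..n. of_nat i :: bit) = 0 \<longleftrightarrow> 4 dvd n"
proof -
  obtain m where m: "n = 2 * m" using assms by blast
  have "4 dvd 2 * m \<longleftrightarrow> even m" using dvd_mult_cancel_left[of 2 2 m] by simp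
  then show ?thesis by (simp only: m sum_of_nat_bit of_nat_bit_eq_0_iff)
qed

text \<open>If \<open>4\<close> divides \<open>n\<close>, the functional of the all-ones vector is the coordinate sum,
  which is the constant \<open>1 + \<dots> + n = 0\<close>.\<close>

lemma act_ones:
  assumes "4 dvd n" "x \<in> codes n"
  shows "act n (ones n, id) x = x"
proof -
  obtain w t where x: "x = (w, t)" by (cases x)
  have "even n" using assms(1) dvd_trans[of 2 4 n] by simp
  then have n: "of_nat n = (0 :: bit)" by (simp add: of_nat_bit_eq_0_iff)
  have w: "w \<in> states n" "(\<Sum>i = 1..n. w i) = 0"
    using assms sum_of_nat_bit_eq_0[OF \<open>even n\<close>] by (simp_all add: x codes_def)
  then have "dot n (ones n) w = 0" by (simp add: dot_def ones_def)
  then show ?thesis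
    using w by (auto simp: act_def x n intro!: states_eqI[of _ n])
qed

text \<open>Comparing the action on a code \<open>w\<close> with that on a code \<open>w'\<close> which differs from
  \<open>w\<close> in two positions eliminates the translation and the constants: the permutation must preserve every
  pair of positions, and for even \<open>n\<close> the vector \<open>c\<close> must have equal entries at any two
  positions.\<close>

lemma act_trivial_imp:
  assumes n: "n > 2" and c: "c \<in> perp n" and p: "p permutes {1..n}"
    and triv: "\<And>x. x \<in> codes n \<Longrightarrow> act n (c, p) x = x"
  shows "p = id" and "c = (\<lambda>i\<in>{1..n}. 0) \<or> 4 dvd n \<and> c = ones n"
proof -
  have word: "(\<lambda>k\<in>{1..n}. coord_action p w k + of_nat n * c k) = w"
       "dot n c (coord_action p w) + of_nat n * half_weight n c = 0"
    if "w \<in> states n" "(\<Sum>i = 1..n. w i) = (\<Sum>i = 1..n. of_nat i)" for w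
    using triv[of "(w, 0)"] that by (simp_all add: codes_def act_def)
  \<comment> \<open>Some code is needed as a base point; that of the zero state will do.\<close>
  define w where "w = fst (encode n (\<lambda>i\<in>{1..n}. 0))"
  have "(w, snd (encode n (\<lambda>i\<in>{1..n}. 0))) \<in> codes n"
    unfolding w_def using n encode_in_codes by simp
  then have w: "w \<in> states n" "(\<Sum>i = 1..n. w i) = (\<Sum>i = 1..n. of_nat i)"
    by (simp_all add: codes_def)
  define w' where "w' i j = (\<lambda>k\<in>{1..n}. w k + unit_pair n i j k)" for i j
  have w': "w' i j \<in> states n" "(\<Sum>k = 1..n. w' i j k) = (\<Sum>i = 1..n. of_nat i)"
    if "i \<in> {1..n}" "j \<in> {1..n}" "i \<noteq> j" for i j
    using unit_pair_perp[OF that] w by (simp_all add: w'_def sum.distrib perp_def)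
  have fixed: "inv' p k = k" if k: "k \<in> {1..n}" for k
  proof (rule ccontr)
    assume neq: "inv' p k \<noteq> k"
    have ik: "inv' p k \<in> {1..n}"
      using permutes_in_image[OF permutes_inv[OF p]] k by blast
    \<comment> \<open>A third position, so that exactly one of \<open>k\<close> and its preimage is flipped in \<open>w'\<close>.\<close>
    obtain j where j: "j \<in> {1..n}" "j \<noteq> k" "j \<noteq> inv' p k"
    proof -
      have "card ({1..n} - {k, inv' p k}) > 0"
        using n card_Diff_subset[of "{k, inv' p k}" "{1..n}"] k ik neq by simp
      then have "{1..n} - {k, inv' p k} \<noteq> {}" by (metis card.empty less_irrefl)
      then show ?thesis using that by blast
    qed
    have 1: "w (inv' p k) + of_nat n * c k = w k"
      using fun_cong[OF word(1)[OF w], of k] k by (simp add: coord_action_def)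
    have 2: "w' k j (inv' p k) + of_nat n * c k = w' k j k"
      using fun_cong[OF word(1)[OF w'[of k j]], of k] k j by (simp add: coord_action_def)
    have "w' k j (inv' p k) = w (inv' p k)" "w' k j k = w k + 1"
      using k ik j neq by (auto simp: w'_def unit_pair_apply)
    with 1 2 show False by simp
  qed
  have "inv' p = id"
    using fixed permutes_not_in[OF permutes_inv[OF p]] by (auto simp: fun_eq_iff)
  then show "p = id"
    using permutes_inv_inv[OF p] by simp
  then have word': "w k + of_nat n * c k = w k" if "k \<in> {1..n}" for k
    using fun_cong[OF word(1)[OF w], of k] that by simp
  show "c = (\<lambda>i\<in>{1..n}. 0) \<or> 4 dvd n \<and> c = ones n"
  proof (cases "even n")
    case False
    then have "of_nat n \<noteq> (0 :: bit)" by (simp only: of_nat_bit_eq_0_iff) simp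
    then have "of_nat n = (1 :: bit)" by (rule bit_not_zero_iff[THEN iffD1])
    then have "c k = 0" if "k \<in> {1..n}" for k
      using word'[OF that] by simp
    then show ?thesis
      using c by (intro disjI1 states_eqI[of _ n]) (auto simp: perp_states)
  next
    case True
    then have n0: "of_nat n = (0 :: bit)" by (simp add: of_nat_bit_eq_0_iff)
    have dot: "dot n c w = 0" "dot n c (w' i j) = 0"
      if "i \<in> {1..n}" "j \<in> {1..n}" "i \<noteq> j" for i j
      using word(2)[OF w] word(2)[OF w'[OF that]] by (simp_all add: \<open>p = id\<close> n0)
    have const: "c i = c 1" if "i \<in> {1..n}" for i
    proof (cases "i = 1")
      case False
      then have "dot n c (unit_pair n i 1) = 0"
        using dot[of i 1] that n by (simp add: w'_def dot_add_right)
      then show ?thesis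
        using False that n dot_unit_pair[of i n 1 c] dot_commute[of n c] by simp
    qed simp
    show ?thesis
    proof (cases "c 1 = 0")
      case True
      then show ?thesis
        using c const by (intro disjI1 states_eqI[of _ n]) (auto simp: perp_states)
    next
      case False
      then have ones: "c = ones n"
        using c const by (intro states_eqI[of _ n]) (auto simp: perp_states ones_def)
      have "dot n c w = (\<Sum>i = 1..n. of_nat i)"
        using w(2) by (simp add: ones dot_def ones_def)
      then have "4 dvd n"
        using dot(1)[of 1 2] n sum_of_nat_bit_eq_0[OF \<open>even n\<close>] by simp
      then show ?thesis using ones by simp
    qed
  qed
qed

text \<open>Homomorphisms map the subgroup generated by a set onto the subgroup generated by its image.\<close>

lemma carrier_G105:
  assumes "n > 2"
  shows "carrier (G105 n) = state_perm n ` carrier (perp_sym n)"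
proof -
  have "group_hom (perp_sym n) (BijGroup (states n)) (state_perm n)"
    using assms by (intro group_hom.intro group_hom_axioms.intro perp_sym_group group_BijGroup
        state_perm_hom) auto
  then interpret group_hom "perp_sym n" "BijGroup (states n)" "state_perm n" .
  have "state_perm n ` generator n ` {1..n} = update105 n ` {1..n}"
    unfolding image_image by (rule image_cong) (simp_all add: state_perm_generator assms)
  moreover have "update105 n ` {1..n} \<subseteq> carrier (BijGroup (states n))"
    using assms update105_in_BijGroup by auto
  ultimately have "carrier (G105 n)
      = generate (BijGroup (states n)) (state_perm n ` generator n ` {1..n})"
    by (simp add: G105_def subgroup_generated_def Int_absorb1)
  also have "\<dots> = state_perm n ` generate (perp_sym n) (generator n ` {1..n})"
    using generator_in_carrier[of n] assms by (intro generate_img image_subsetI) simp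
  finally show ?thesis
    using generate_generators assms by simp
qed

lemma state_perm_group_hom:
  assumes "n > 2"
  shows "group_hom (perp_sym n) (G105 n) (state_perm n)"
proof -
  have "state_perm n \<in> hom (perp_sym n) (G105 n)"
    using state_perm_hom[of n] carrier_G105[OF assms] assms
    by (auto simp: hom_def G105_def subgroup_generated_def)
  moreover have "group (G105 n)"
    unfolding G105_def by (intro group.group_subgroup_generated group_BijGroup)
  ultimately show ?thesis
    by (intro group_hom.intro group_hom_axioms.intro perp_sym_group)
qed

text \<open>States and codes correspond bijectively, so a trivial permutation of states is a trivial action on
  codes.\<close>

lemma kernel_state_perm:
  assumes "n > 2"
  shows "kernel (perp_sym n) (G105 n) (state_perm n)
    = {(c, id) | c. c = (\<lambda>i\<in>{1..n}. 0) \<or> 4 dvd n \<and> c = ones n}"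
proof -
  have one: "\<one>\<^bsub>G105 n\<^esub> = (\<lambda>y\<in>states n. y)"
    by (simp add: G105_def subgroup_generated_def BijGroup_def)
  have trivial: "state_perm n g = (\<lambda>y\<in>states n. y) \<longleftrightarrow> (\<forall>x\<in>codes n. act n g x = x)"
    if g: "g \<in> carrier (perp_sym n)" for g
  proof
    assume triv: "state_perm n g = (\<lambda>y\<in>states n. y)"
    show "\<forall>x\<in>codes n. act n g x = x"
    proof
      fix x assume x: "x \<in> codes n"
      have "decode n (act n g x) = decode n x"
        using fun_cong[OF triv, of "decode n x"] x assms
        by (simp add: state_perm_def decode_in_states encode_decode)
      then have "encode n (decode n (act n g x)) = encode n (decode n x)" by simp
      moreover have "act n g x \<in> codes n" using g x act_in_codes by (cases g) auto
      ultimately show "act n g x = x" using assms x by (simp add: encode_decode)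
    qed
  next
    assume "\<forall>x\<in>codes n. act n g x = x"
    then show "state_perm n g = (\<lambda>y\<in>states n. y)"
      using assms by (auto simp: state_perm_def encode_in_codes decode_encode fun_eq_iff)
  qed
  show ?thesis (is "?ker = ?K")
  proof
    show "?ker \<subseteq> ?K"
    proof
      fix g assume g: "g \<in> ?ker"
      obtain c p where cp: "g = (c, p)" by (cases g)
      have carr: "g \<in> carrier (perp_sym n)" and "state_perm n g = (\<lambda>y\<in>states n. y)"
        using g unfolding kernel_def one by blast+
      then have "act n (c, p) x = x" if "x \<in> codes n" for x
        using trivial[OF carr] that unfolding cp by blast
      then show "g \<in> ?K"
        using act_trivial_imp[OF assms, of c p] carr unfolding cp by simp
    qed
    show "?K \<subseteq> ?ker"
    proof
      fix g assume "g \<in> ?K"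
      then obtain c where g: "g = (c, id)" and "c = (\<lambda>i\<in>{1..n}. 0) \<or> 4 dvd n \<and> c = ones n"
        by blast
      then consider "c = (\<lambda>i\<in>{1..n}. 0)" | "4 dvd n" "c = ones n" by blast
      then have "g \<in> carrier (perp_sym n) \<and> (\<forall>x\<in>codes n. act n g x = x)"
      proof cases
        case 1
        then show ?thesis using act_id by (simp add: g permutes_id)
      next
        case 2
        then have "even n" using dvd_trans[of 2 4 n] by simp
        with 2 show ?thesis using act_ones ones_perp by (simp add: g permutes_id)
      qed
      then show "g \<in> ?ker"
        using trivial unfolding kernel_def one by blast
    qed
  qed
qed

section \<open>The quotient by the all-ones vector\<close>

lemma perp_ones_comm_group: "comm_group (perp_ones n)"
  by (rule group.group_comm_groupI[OF perp_ones_group]) (simp add: add.commute)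

lemma generate_ones:
  assumes "even n"
  shows "generate (perp_ones n) {ones n} = {\<lambda>i\<in>{1..n}. 0, ones n}"
proof -
  interpret group "perp_ones n" by (rule perp_ones_group)
  have ones: "ones n \<in> carrier (perp_ones n)" using ones_perp[OF assms] by simp
  have self: "ones n \<otimes>\<^bsub>perp_ones n\<^esub> ones n = \<one>\<^bsub>perp_ones n\<^esub>"
    by (auto simp: ones_def)
  have inv: "inv\<^bsub>perp_ones n\<^esub> ones n = ones n"
    by (rule inv_equality[OF self ones ones])
  have "subgroup {\<one>\<^bsub>perp_ones n\<^esub>, ones n} (perp_ones n)"
    by (rule subgroupI) (use ones self inv in \<open>auto simp del: mult_perp_ones one_perp_ones carrier_perp_ones\<close>)
  then have "generate (perp_ones n) {ones n} \<subseteq> {\<one>\<^bsub>perp_ones n\<^esub>, ones n}"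
    by (intro generate_subgroup_incl) auto
  moreover have "{\<one>\<^bsub>perp_ones n\<^esub>, ones n} \<subseteq> generate (perp_ones n) {ones n}"
    by (auto simp del: one_perp_ones intro: generate.one generate.incl)
  ultimately have "generate (perp_ones n) {ones n} = {\<one>\<^bsub>perp_ones n\<^esub>, ones n}"
    by (rule subset_antisym)
  then show ?thesis by simp
qed

text \<open>The projection \<open>(c, p) \<mapsto> (c + \<langle>1\<rangle>, p)\<close>. It is compatible with the
  products because the all-ones vector is fixed by every permutation of coordinates, so that permuting the coset of
  \<open>c\<close> gives the coset of the permuted \<open>c\<close>.\<close>

lemma quotient_hom:
  assumes n: "even n"
  defines "K \<equiv> generate (perp_ones n) {ones n}"
  defines "\<pi> \<equiv> \<lambda>(c, p). (K #>\<^bsub>perp_ones n\<^esub> c, p)"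
  shows "group_hom (perp_sym n) (semidirect (perp_ones_quot n) coset_action (sym_group n)) \<pi>"
    and "\<pi> ` carrier (perp_sym n) = carrier (semidirect (perp_ones_quot n) coset_action (sym_group n))"
    and "kernel (perp_sym n) (semidirect (perp_ones_quot n) coset_action (sym_group n)) \<pi>
      = {(c, id) | c. c = (\<lambda>i\<in>{1..n}. 0) \<or> c = ones n}"
proof -
  interpret comm_group "perp_ones n" by (rule perp_ones_comm_group)
  let ?N = "perp_ones n" and ?W = "perp_sym n"
    and ?Q = "semidirect (perp_ones_quot n) coset_action (sym_group n)"
  have K: "K = {\<lambda>i\<in>{1..n}. 0, ones n}"
    unfolding K_def by (rule generate_ones[OF n])
  have ones: "ones n \<in> perp n" using n by (rule ones_perp)
  have sub: "subgroup K ?N"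
    unfolding K_def using ones by (intro generate_is_subgroup) simp
  then interpret normal K ?N by (simp add: normal_iff_subgroup)
  have coset: "coset_action p (K #>\<^bsub>?N\<^esub> c) = K #>\<^bsub>?N\<^esub> coord_action p c"
    if p: "p permutes {1..n}" for p c
  proof -
    have fixed: "coord_action p h = h" if "h \<in> K" for h
      using that coord_action_const[OF p] by (auto simp: K ones_def)
    have "coord_action p (h \<otimes>\<^bsub>?N\<^esub> c) = h \<otimes>\<^bsub>?N\<^esub> coord_action p c" if "h \<in> K" for h
      using coord_action_pointwise[OF p, of "(+)" h c] fixed[OF that] by simp
    then show ?thesis
      by (simp add: coset_action_def r_coset_def image_UN del: mult_perp_ones)
  qed
  have hom: "\<pi> \<in> hom ?W ?Q"
  proof (rule homI)
    fix g h assume g: "g \<in> carrier ?W" and h: "h \<in> carrier ?W"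
    obtain c p d q where gh: "g = (c, p)" "h = (d, q)" by (cases g, cases h)
    show "\<pi> g \<in> carrier ?Q"
      using g by (auto simp: gh \<pi>_def semidirect_def perp_ones_quot_def FactGroup_def sym_group_def
          RCOSETS_def simp flip: K_def)
    have "(K #>\<^bsub>?N\<^esub> c) <#>\<^bsub>?N\<^esub> coset_action p (K #>\<^bsub>?N\<^esub> d)
        = K #>\<^bsub>?N\<^esub> (c \<otimes>\<^bsub>?N\<^esub> coord_action p d)"
      using g h unfolding gh by (subst coset) (auto intro!: rcos_sum simp del: mult_perp_ones)
    then show "\<pi> (g \<otimes>\<^bsub>?W\<^esub> h) = \<pi> g \<otimes>\<^bsub>?Q\<^esub> \<pi> h"
      by (simp add: gh \<pi>_def semidirect_def perp_ones_quot_def sym_group_def flip: K_def)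
  qed
  show surj: "\<pi> ` carrier ?W = carrier ?Q"
    by (auto simp: \<pi>_def semidirect_def perp_ones_quot_def FactGroup_def sym_group_def
        RCOSETS_def image_iff simp flip: K_def)
  have one: "\<pi> \<one>\<^bsub>?W\<^esub> = \<one>\<^bsub>?Q\<^esub>"
    using coset_join2[OF monoid.one_closed[OF group.is_monoid[OF perp_ones_group]]
        sub subgroup.one_closed[OF sub]]
    by (simp add: \<pi>_def semidirect_def perp_ones_quot_def sym_group_def flip: K_def)
  have "group ?Q"
    using perp_sym_group hom surj one by (rule group_hom_image)
  then show "group_hom ?W ?Q \<pi>"
    using hom by (intro group_hom.intro group_hom_axioms.intro perp_sym_group)
  have "K #>\<^bsub>?N\<^esub> c = K \<longleftrightarrow> c \<in> K" if "c \<in> perp n" for c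
    using coset_join1[OF _ _ sub] coset_join2[OF _ sub] that subgroup.subset[OF sub] by auto
  moreover have "\<one>\<^bsub>?Q\<^esub> = (K, id)"
    by (simp add: semidirect_def perp_ones_quot_def sym_group_def flip: K_def)
  ultimately have "kernel ?W ?Q \<pi> = {(c, id) | c. c \<in> K}"
    using subgroup.subset[OF sub] by (auto simp: kernel_def \<pi>_def permutes_id)
  then show "kernel ?W ?Q \<pi> = {(c, id) | c. c = (\<lambda>i\<in>{1..n}. 0) \<or> c = ones n}"
    by (simp add: K)
qed

section \<open>The structure of the dynamics group\<close>

theorem theorem5p5:
  fixes n :: nat
  assumes "n > 3"
  shows "(\<not> 4 dvd n \<longrightarrow>
            G105 n \<cong> semidirect (perp_ones n) coord_action (sym_group n) \<and>
            order (G105 n) = 2 ^ (n - 1) * fact n) \<and>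
         (4 dvd n \<longrightarrow>
            G105 n \<cong> semidirect (perp_ones_quot n) coset_action (sym_group n) \<and>
            order (G105 n) = 2 ^ (n - 2) * fact n)"
proof (intro conjI impI)
  have n: "n > 2" "n > 0" using assms by simp_all
  note hom = state_perm_group_hom[OF n(1)] and surj = carrier_G105[OF n(1), symmetric]
  note order = order_kernel_image[OF hom surj] order_perp_sym[OF n(2)]
  {
    assume "\<not> 4 dvd n"
    then have ker: "kernel (perp_sym n) (G105 n) (state_perm n) = {\<one>\<^bsub>perp_sym n\<^esub>}"
      by (simp add: kernel_state_perm[OF n(1)])
    then have "state_perm n \<in> iso (perp_sym n) (G105 n)"
      using hom surj by (simp add: iso_kernel_image group_hom_def group_hom_axioms_def)
    then show "G105 n \<cong> perp_sym n"
      using group.iso_sym[OF perp_sym_group] by (auto simp: is_iso_def)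
    show "order (G105 n) = 2 ^ (n - 1) * fact n"
      using order by (simp add: ker)
  next
    assume 4: "4 dvd n"
    then have "even n" using dvd_trans[of 2 4 n] by simp
    have ker: "kernel (perp_sym n) (G105 n) (state_perm n)
        = {(c, id) | c. c = (\<lambda>i\<in>{1..n}. 0) \<or> c = ones n}"
      using 4 by (simp add: kernel_state_perm[OF n(1)])
    show "G105 n \<cong> semidirect (perp_ones_quot n) coset_action (sym_group n)"
      using iso_if_same_kernel[OF hom surj quotient_hom(1,2)[OF \<open>even n\<close>]]
        quotient_hom(3)[OF \<open>even n\<close>] ker by simp
    have "(\<lambda>i\<in>{1..n}. 0) \<noteq> ones n"
      using n by (auto simp: ones_def fun_eq_iff)
    moreover have "kernel (perp_sym n) (G105 n) (state_perm n) = {(\<lambda>i\<in>{1..n}. 0, id), (ones n, id)}"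
      unfolding ker by blast
    ultimately have "card (kernel (perp_sym n) (G105 n) (state_perm n)) = 2" by simp
    moreover have "(2 :: nat) ^ (n - 1) = 2 * 2 ^ (n - 2)"
      using n by (simp add: Suc_diff_Suc numeral_2_eq_2 flip: power_Suc)
    ultimately show "order (G105 n) = 2 ^ (n - 2) * fact n"
      using order by simp
  }
qed

end
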